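(* Suppose $M$ is a metric linear order, understood as a $\{r\}$-structure. Then every strongly regulated function $f: M \to [0,1]$ that is continuous with respect to the metric is given by a quantifier-free definable predicate with parameters from $M$ in the language $\{r\}$.
   Context: A metric linear order is a set $M$ with a linear order $\le$ and metric $d$ (diameter $\le 1$) such that every open ball is order-convex; $r(x,y)=\inf_{z\le y}d(x,z)$ is the distance from $x$ to the ray $(-\infty,y]$. A quantifier-free definable predicate with parameters is a uniform limit of quantifier-free formulas (continuous combinations of atomic formulas $d(\cdot,\cdot)$, $r(\cdot,\cdot)$ applied to variables and parameters). A function $f:M\to\mathbb{R}$ is strongly regulated if it is a uniform limit of functions in the $\mathbb{R}$-linear span of characteristic functions of intervals of $M$. *)

theory Defs
  imports "HOL-Analysis.Analysis"
begin

text \<open>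
  The topology of the type is the one induced by the metric; no relation to the order topology is
  assumed. Since constants such as \<^const>\<open>ball\<close> are not available inside a class specification,
  the second axiom spells out that the open ball of radius \<open>e\<close> about \<open>c\<close> is order-convex.
\<close>

class metric_linear_order = metric_space + linorder +
  assumes dist_le_1: "dist x y \<le> 1"
    and ball_order_convex:
      "dist c x < e \<Longrightarrow> dist c z < e \<Longrightarrow> x \<le> y \<Longrightarrow> y \<le> z \<Longrightarrow> dist c y < e"

definition ray_dist :: "'a::metric_linear_order \<Rightarrow> 'a \<Rightarrow> real" where
  "ray_dist x y = (INF z\<in>{..y}. dist x z)"

text \<open>
  Quantifier-free formulas of continuous logic over the language \<open>{r}\<close>, with variables indexed by
  the type \<open>'v\<close> and parameters from \<open>'a\<close>. The metric is always present as a logical symbol.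
  A connective applied to \<open>n\<close> formulas is a continuous map from \<open>[0,1]^n\<close> to \<open>[0,1]\<close>
  (constants are the case \<open>n = 0\<close>); this is enforced by \<open>qf_wf\<close>. Tuples in \<open>[0,1]^n\<close> are
  represented as extensional functions on \<open>{..<n}\<close>.
\<close>

datatype ('v, 'a) qf_term = Var 'v | Param 'a

datatype ('v, 'a) qf_formula =
    Dist "('v, 'a) qf_term" "('v, 'a) qf_term"
  | Ray "('v, 'a) qf_term" "('v, 'a) qf_term"
  | Conn "(nat \<Rightarrow> real) \<Rightarrow> real" "('v, 'a) qf_formula list"

primrec qf_wf :: "('v, 'a) qf_formula \<Rightarrow> bool" where
  "qf_wf (Dist s t) \<longleftrightarrow> True"
| "qf_wf (Ray s t) \<longleftrightarrow> True"
| "qf_wf (Conn u \<phi>s) \<longleftrightarrow>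
     continuous_map (product_topology (\<lambda>_. top_of_set {0..1}) {..<length \<phi>s})
       (top_of_set {0..1}) u
     \<and> list_all (\<lambda>b. b) (map qf_wf \<phi>s)"

primrec term_val :: "('v \<Rightarrow> 'a) \<Rightarrow> ('v, 'a) qf_term \<Rightarrow> 'a" where
  "term_val \<sigma> (Var v) = \<sigma> v"
| "term_val \<sigma> (Param a) = a"

primrec qf_val :: "('v \<Rightarrow> 'a::metric_linear_order) \<Rightarrow> ('v, 'a) qf_formula \<Rightarrow> real" where
  "qf_val \<sigma> (Dist s t) = dist (term_val \<sigma> s) (term_val \<sigma> t)"
| "qf_val \<sigma> (Ray s t) = ray_dist (term_val \<sigma> s) (term_val \<sigma> t)"
| "qf_val \<sigma> (Conn u \<phi>s) = u (restrict (\<lambda>i. map (qf_val \<sigma>) \<phi>s ! i) {..<length \<phi>s})"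

definition qf_definable :: "(('v \<Rightarrow> 'a::metric_linear_order) \<Rightarrow> real) \<Rightarrow> bool" where
  "qf_definable P \<longleftrightarrow>
     (\<exists>\<phi> :: nat \<Rightarrow> ('v, 'a) qf_formula.
        (\<forall>n. qf_wf (\<phi> n)) \<and> uniform_limit UNIV (\<lambda>n \<sigma>. qf_val \<sigma> (\<phi> n)) P sequentially)"

text \<open>
  Intervals have endpoints in \<open>M \<union> {-\<infinity>, \<infinity>}\<close>; they are not arbitrary order-convex sets.
\<close>

definition order_interval :: "'a::linorder set \<Rightarrow> bool" where
  "order_interval I \<longleftrightarrow>
     (\<exists>a b. I \<in> {UNIV, {..b}, {..<b}, {a..}, {a<..}, {a..b}, {a..<b}, {a<..b}, {a<..<b}})"

definition step_function :: "('a::linorder \<Rightarrow> real) \<Rightarrow> bool" where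
  "step_function g \<longleftrightarrow>
     (\<exists>S c. finite S \<and> (\<forall>I\<in>S. order_interval I) \<and> g = (\<lambda>x. \<Sum>I\<in>S. c I * indicator I x))"

definition strongly_regulated :: "('a::linorder \<Rightarrow> real) \<Rightarrow> bool" where
  "strongly_regulated f \<longleftrightarrow>
     (\<exists>g :: nat \<Rightarrow> 'a \<Rightarrow> real.
        (\<forall>n. step_function (g n)) \<and> uniform_limit UNIV g f sequentially)"

end

theory Submission
  imports Defs
begin

text \<open>
  Approximate \<open>f\<close> up to \<open>\<epsilon>\<close> by a step function with finite endpoint set \<open>A\<close>, and consider the atomic
  formulas \<open>d(x,a)\<close> and \<open>r(x,a)\<close> for \<open>a \<in> A\<close>. Let these have nearby values at \<open>x \<le> y\<close>. If no \<open>a \<in> A\<close>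
  lies between \<open>x\<close> and \<open>y\<close>, the step function agrees at \<open>x\<close> and \<open>y\<close>. If \<open>x \<le> a \<le> y\<close>, then \<open>r(x,a) = 0\<close>,
  whereas \<open>r(y,a) = d(y,a)\<close> because balls about \<open>y\<close> are convex; so \<open>x\<close> and \<open>y\<close> are both close to \<open>a\<close>
  and continuity of \<open>f\<close> at \<open>a\<close> applies. Either way \<open>f x\<close> and \<open>f y\<close> are close, and a McShane-type
  extension yields a continuous connective of the atomic formulas that approximates \<open>f\<close>.
\<close>

lemma ray_dist_eq_0:
  assumes "x \<le> a"
  shows "ray_dist x a = 0"
proof (rule antisym)
  have "ray_dist x a \<le> dist x x"
    unfolding ray_dist_def using assms by (intro cINF_lower bdd_belowI2[where m=0]) auto
  then show "ray_dist x a \<le> 0" by simp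
  show "0 \<le> ray_dist x a"
    unfolding ray_dist_def by (intro cINF_greatest) auto
qed

lemma ray_dist_eq_dist:
  assumes "a \<le> x"
  shows "ray_dist x a = dist x a"
proof (rule antisym)
  show "ray_dist x a \<le> dist x a"
    unfolding ray_dist_def by (intro cINF_lower bdd_belowI2[where m=0]) auto
  \<comment> \<open>If some \<open>z\<close> below \<open>a\<close> were strictly closer to
    \<open>x\<close> than \<open>a\<close> is, the ball about \<open>x\<close> of radius
    \<open>dist x a\<close> would contain \<open>z\<close> and \<open>x\<close>, hence by convexity
    also \<open>a\<close>, which lies between them.\<close>
  have "dist x a \<le> dist x z" if "z \<le> a" for z
    using ball_order_convex[of x z "dist x a" x a] that assms by force
  then show "dist x a \<le> ray_dist x a"
    unfolding ray_dist_def by (intro cINF_greatest) auto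
qed

text \<open>Membership can change only across an endpoint. The set \<open>{a, b}\<close> serves all
  nine shapes at once: a bound that a shape lacks keeps an arbitrary value, and enlarging
  \<open>A\<close> only leaves fewer pairs to check.\<close>

lemma order_interval_endpoints:
  fixes I :: "'a::linorder set"
  assumes "order_interval I"
  obtains A where "finite A" "\<And>x y. x \<le> y \<Longrightarrow> A \<inter> {x..y} = {} \<Longrightarrow> x \<in> I \<longleftrightarrow> y \<in> I"
proof -
  obtain a b where I: "I \<in> {UNIV, {..b}, {..<b}, {a..}, {a<..}, {a..b}, {a..<b}, {a<..b}, {a<..<b}}"
    using assms unfolding order_interval_def by blast
  have "x \<in> I \<longleftrightarrow> y \<in> I" if "x \<le> y" "{a, b} \<inter> {x..y} = {}" for x y
  proof -
    have "a < x \<or> y < a" "b < x \<or> y < b"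
      using that by (auto simp: not_le)
    then show ?thesis
      using I \<open>x \<le> y\<close> by (elim insertE emptyE) (auto simp: not_le)
  qed
  then show thesis
    using that[of "{a, b}"] by blast
qed

lemma step_function_endpoints:
  fixes g :: "'a::linorder \<Rightarrow> real"
  assumes "step_function g"
  obtains A where "finite A" "\<And>x y. x \<le> y \<Longrightarrow> A \<inter> {x..y} = {} \<Longrightarrow> g x = g y"
proof -
  obtain S c where S: "finite S" "\<forall>I\<in>S. order_interval I"
    and g: "g = (\<lambda>x. \<Sum>I\<in>S. c I * indicator I x)"
    using assms unfolding step_function_def by blast
  have "\<forall>I\<in>S. \<exists>A. finite A \<and> (\<forall>x y. x \<le> y \<longrightarrow> A \<inter> {x..y} = {} \<longrightarrow> (x \<in> I \<longleftrightarrow> y \<in> I))"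
    using S(2) order_interval_endpoints by metis
  then obtain E where E: "\<And>I. I \<in> S \<Longrightarrow> finite (E I)"
    "\<And>I x y. I \<in> S \<Longrightarrow> x \<le> y \<Longrightarrow> E I \<inter> {x..y} = {} \<Longrightarrow> x \<in> I \<longleftrightarrow> y \<in> I"
    by metis
  have "g x = g y" if "x \<le> y" "\<Union> (E ` S) \<inter> {x..y} = {}" for x y
    unfolding g
  proof (rule sum.cong[OF refl])
    fix I assume "I \<in> S"
    then have "x \<in> I \<longleftrightarrow> y \<in> I" using E(2)[of I x y] that by blast
    then show "c I * indicator I x = c I * indicator I y" by (simp add: indicator_def)
  qed
  moreover have "finite (\<Union> (E ` S))" using S(1) E(1) by simp
  ultimately show thesis by (rule that[rotated])
qed

text \<open>Well-formed connectives must be continuous for an abstract product topology, so a family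
  of continuous moduli \<open>m p\<close> takes the place of a metric: the set where
  \<open>m p\<close> is below \<open>e\<close> is an open neighbourhood of \<open>p\<close> on which
  \<open>u\<close> stays within \<open>e\<close> of \<open>u p\<close>.\<close>

lemma continuous_map_real_modulus:
  fixes u :: "'b \<Rightarrow> real"
  assumes m: "\<And>p. p \<in> topspace X \<Longrightarrow> continuous_map X euclideanreal (m p)"
    and m0: "\<And>p. p \<in> topspace X \<Longrightarrow> m p p = 0"
    and u: "\<And>p q. p \<in> topspace X \<Longrightarrow> q \<in> topspace X \<Longrightarrow> \<bar>u p - u q\<bar> \<le> m p q"
  shows "continuous_map X euclideanreal u"
  unfolding continuous_map_eq_topcontinuous_at topcontinuous_at_def
proof (intro ballI conjI allI impI)
  fix p V assume p: "p \<in> topspace X" and "openin euclideanreal V \<and> u p \<in> V"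
  then obtain e where e: "e > 0" "ball (u p) e \<subseteq> V"
    by (auto simp: open_contains_ball)
  let ?U = "{q \<in> topspace X. m p q \<in> {..<e}}"
  have "openin X ?U"
    by (rule openin_continuous_map_preimage[OF m[OF p]]) auto
  moreover have "u q \<in> V" if "q \<in> ?U" for q
    using u[OF p, of q] that e(2) by (force simp: dist_real_def)
  ultimately show "\<exists>U. openin X U \<and> p \<in> U \<and> (\<forall>q\<in>U. u q \<in> V)"
    using p m0[OF p] e(1) by (intro exI[of _ ?U]) auto
qed auto

text \<open>The values of \<open>\<phi>s\<close> determine \<open>f\<close> up to \<epsilon>, but
  only on attained tuples; the McShane infimum \<open>v\<close> extends this to a Lipschitz function
  of all tuples. The slope 1/\<delta> makes tuples at distance at least \<delta> cost at least 1,
  the whole range of \<open>f\<close>.\<close>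

lemma qf_formula_approx:
  fixes f :: "('v \<Rightarrow> 'a::metric_linear_order) \<Rightarrow> real" and \<phi>s :: "('v, 'a) qf_formula list"
  assumes f01: "\<And>\<sigma>. f \<sigma> \<in> {0..1}"
    and wf: "\<And>\<phi>. \<phi> \<in> set \<phi>s \<Longrightarrow> qf_wf \<phi>"
    and \<delta>: "\<delta> > 0" and \<epsilon>: "\<epsilon> \<ge> 0"
    and mod: "\<And>\<sigma> \<tau>. (\<And>\<phi>. \<phi> \<in> set \<phi>s \<Longrightarrow> \<bar>qf_val \<sigma> \<phi> - qf_val \<tau> \<phi>\<bar> < \<delta>) \<Longrightarrow> f \<sigma> \<le> f \<tau> + \<epsilon>"
  obtains \<psi> :: "('v, 'a) qf_formula"
  where "qf_wf \<psi>" "\<And>\<sigma>. \<bar>qf_val \<sigma> \<psi> - f \<sigma>\<bar> \<le> \<epsilon>"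
proof -
  define n where "n = length \<phi>s"
  define \<Phi> where "\<Phi> \<sigma> = restrict (\<lambda>i. map (qf_val \<sigma>) \<phi>s ! i) {..<n}" for \<sigma>
  \<comment> \<open>The sum dominates each coordinate difference, so a value below \<delta> yields
    the premise of \<open>mod\<close>.\<close>
  define d :: "(nat \<Rightarrow> real) \<Rightarrow> (nat \<Rightarrow> real) \<Rightarrow> real" where "d p q = (\<Sum>i<n. \<bar>p i - q i\<bar>)" for p q
  define v where "v p = (INF \<sigma>. f \<sigma> + d p (\<Phi> \<sigma>) / \<delta>)" for p
  \<comment> \<open>The infimum is nonnegative but may exceed 1 at tuples far from all attained
    ones. Since \<open>f\<close> is at most 1, truncation does no harm at attained tuples.\<close>
  define u where "u p = min 1 (v p)" for p
  have d_nonneg: "0 \<le> d p q" for p q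
    unfolding d_def by (intro sum_nonneg) auto
  have d_tri: "d p s \<le> d p q + d q s" for p q s
    unfolding d_def sum.distrib[symmetric] by (intro sum_mono) auto
  have d_sym: "d p q = d q p" for p q
    unfolding d_def by (intro sum.cong) auto
  have nonneg: "0 \<le> f \<sigma> + d p (\<Phi> \<sigma>) / \<delta>" for p \<sigma>
    using f01[of \<sigma>] d_nonneg[of p "\<Phi> \<sigma>"] \<delta> by auto
  have v_le: "v p \<le> f \<sigma> + d p (\<Phi> \<sigma>) / \<delta>" for p \<sigma>
    unfolding v_def by (intro cINF_lower bdd_belowI2[where m=0] nonneg) auto
  have v_ge: "c \<le> v p" if "\<And>\<sigma>. c \<le> f \<sigma> + d p (\<Phi> \<sigma>) / \<delta>" for c p
    unfolding v_def using that by (intro cINF_greatest) auto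
  have v_lip: "v p - d p q / \<delta> \<le> v q" for p q
  proof (rule v_ge)
    fix \<sigma>
    have "d p (\<Phi> \<sigma>) / \<delta> \<le> d p q / \<delta> + d q (\<Phi> \<sigma>) / \<delta>"
      using d_tri[of p "\<Phi> \<sigma>" q] \<delta> by (simp add: divide_simps)
    then show "v p - d p q / \<delta> \<le> f \<sigma> + d q (\<Phi> \<sigma>) / \<delta>"
      using v_le[of p \<sigma>] by linarith
  qed
  have u_lip: "\<bar>u p - u q\<bar> \<le> d p q / \<delta>" for p q
    using v_lip[of p q] v_lip[of q p] d_sym[of p q] d_nonneg[of p q] \<delta>
    unfolding u_def by (auto simp: min_def)
  have u01: "u p \<in> {0..1}" for p
    unfolding u_def using v_ge[of 0 p] nonneg by auto
  let ?X = "product_topology (\<lambda>_::nat. top_of_set {0..1::real}) {..<n}"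
  have proj: "continuous_map ?X euclideanreal (\<lambda>q. q i)" if "i < n" for i
    using continuous_map_product_projection[of i "{..<n}" "\<lambda>_. top_of_set {0..1::real}"] that
    by (auto simp: continuous_map_in_subtopology)
  have "continuous_map ?X euclideanreal u"
  proof (rule continuous_map_real_modulus)
    show "continuous_map ?X euclideanreal (\<lambda>q. d p q / \<delta>)" for p
      unfolding d_def using \<delta> proj by (intro continuous_intros) auto
    show "d p p / \<delta> = 0" for p by (simp add: d_def)
  qed (rule u_lip)
  then have "continuous_map ?X (top_of_set {0..1}) u"
    using u01 by (auto simp: continuous_map_in_subtopology)
  then have wf_u: "qf_wf (Conn u \<phi>s)"
    using wf by (simp add: n_def list_all_iff)
  have "\<bar>qf_val \<sigma> (Conn u \<phi>s) - f \<sigma>\<bar> \<le> \<epsilon>" for \<sigma>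
  proof -
    have val: "qf_val \<sigma> (Conn u \<phi>s) = u (\<Phi> \<sigma>)"
      by (simp add: \<Phi>_def n_def)
    have "d (\<Phi> \<sigma>) (\<Phi> \<sigma>) = 0" by (simp add: d_def)
    \<comment> \<open>Taking \<sigma> itself as competitor in the infimum costs nothing, so the
      error is one-sided.\<close>
    then have "v (\<Phi> \<sigma>) \<le> f \<sigma>" using v_le[of "\<Phi> \<sigma>" \<sigma>] by simp
    moreover have "f \<sigma> - \<epsilon> \<le> v (\<Phi> \<sigma>)"
    proof (rule v_ge)
      fix \<tau>
      show "f \<sigma> - \<epsilon> \<le> f \<tau> + d (\<Phi> \<sigma>) (\<Phi> \<tau>) / \<delta>"
      proof (cases "d (\<Phi> \<sigma>) (\<Phi> \<tau>) < \<delta>")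
        case True
        have "\<bar>qf_val \<sigma> \<phi> - qf_val \<tau> \<phi>\<bar> < \<delta>" if "\<phi> \<in> set \<phi>s" for \<phi>
        proof -
          obtain i where i: "i < n" "\<phi> = \<phi>s ! i"
            using \<open>\<phi> \<in> set \<phi>s\<close> by (auto simp: in_set_conv_nth n_def)
          have "\<bar>\<Phi> \<sigma> i - \<Phi> \<tau> i\<bar> \<le> d (\<Phi> \<sigma>) (\<Phi> \<tau>)"
            unfolding d_def using i(1)
            by (intro member_le_sum[where f="\<lambda>i. \<bar>\<Phi> \<sigma> i - \<Phi> \<tau> i\<bar>"]) auto
          then show ?thesis using True i by (simp add: \<Phi>_def n_def)
        qed
        then have "f \<sigma> \<le> f \<tau> + \<epsilon>" by (rule mod)
        moreover have "0 \<le> d (\<Phi> \<sigma>) (\<Phi> \<tau>) / \<delta>" using d_nonneg \<delta> by simp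
        ultimately show ?thesis by linarith
      next
        case False
        then have "1 \<le> d (\<Phi> \<sigma>) (\<Phi> \<tau>) / \<delta>" using \<delta> by simp
        then show ?thesis using f01[of \<sigma>] f01[of \<tau>] \<epsilon> by auto
      qed
    qed
    ultimately show ?thesis
      unfolding val u_def using f01[of \<sigma>] by auto
  qed
  with wf_u show thesis by (rule that)
qed

lemma qf_definableI:
  fixes P :: "('v \<Rightarrow> 'a::metric_linear_order) \<Rightarrow> real"
  assumes "\<And>\<epsilon>. \<epsilon> > 0 \<Longrightarrow> \<exists>\<psi> :: ('v, 'a) qf_formula. qf_wf \<psi> \<and> (\<forall>\<sigma>. \<bar>qf_val \<sigma> \<psi> - P \<sigma>\<bar> \<le> \<epsilon>)"
  shows "qf_definable P"
proof -
  have "\<forall>n. \<exists>\<psi> :: ('v, 'a) qf_formula.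
      qf_wf \<psi> \<and> (\<forall>\<sigma>. \<bar>qf_val \<sigma> \<psi> - P \<sigma>\<bar> \<le> inverse (real (Suc n)))"
    by (intro allI assms) simp
  then obtain \<phi> :: "nat \<Rightarrow> ('v, 'a) qf_formula" where \<phi>: "\<And>n. qf_wf (\<phi> n)"
    "\<And>n \<sigma>. \<bar>qf_val \<sigma> (\<phi> n) - P \<sigma>\<bar> \<le> inverse (real (Suc n))"
    by metis
  have "uniform_limit UNIV (\<lambda>n \<sigma>. qf_val \<sigma> (\<phi> n)) P sequentially"
  proof (rule uniform_limitI)
    fix e :: real assume "e > 0"
    then have "\<forall>\<^sub>F n in sequentially. inverse (real (Suc n)) < e"
      using LIMSEQ_inverse_real_of_nat by (rule order_tendstoD(2)[rotated])
    then show "\<forall>\<^sub>F n in sequentially. \<forall>\<sigma>\<in>UNIV. dist (qf_val \<sigma> (\<phi> n)) (P \<sigma>) < e"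
    proof eventually_elim
      case (elim n)
      then show ?case using \<phi>(2) le_less_trans by (fastforce simp: dist_real_def)
    qed
  qed
  with \<phi>(1) show ?thesis unfolding qf_definable_def by blast
qed

text \<open>One step function within \<epsilon>/2 of \<open>f\<close> suffices: it agrees at
  \<open>x\<close> and \<open>y\<close>, so only the two approximation errors remain.\<close>

lemma strongly_regulated_endpoints:
  fixes f :: "'a::linorder \<Rightarrow> real"
  assumes "strongly_regulated f" "\<epsilon> > 0"
  obtains A where "finite A" "\<And>x y. x \<le> y \<Longrightarrow> A \<inter> {x..y} = {} \<Longrightarrow> \<bar>f x - f y\<bar> < \<epsilon>"
proof -
  obtain g where g: "\<And>n. step_function (g n)" "uniform_limit UNIV g f sequentially"
    using assms(1) unfolding strongly_regulated_def by blast
  have "\<forall>\<^sub>F n in sequentially. \<forall>x\<in>UNIV. dist (g n x) (f x) < \<epsilon> / 2"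
    using g(2) assms(2) by (intro uniform_limitD) auto
  then obtain n where n: "\<And>x. \<bar>g n x - f x\<bar> < \<epsilon> / 2"
    by (force simp: dist_real_def eventually_sequentially)
  obtain A where A: "finite A" "\<And>x y. x \<le> y \<Longrightarrow> A \<inter> {x..y} = {} \<Longrightarrow> g n x = g n y"
    using step_function_endpoints[OF g(1)] by blast
  have "\<bar>f x - f y\<bar> < \<epsilon>" if "x \<le> y" "A \<inter> {x..y} = {}" for x y
    using A(2)[OF that] n[of x] n[of y] by linarith
  with A(1) show thesis by (rule that)
qed

lemma continuous_finite_uniform_radius:
  fixes f :: "'a::metric_space \<Rightarrow> real"
  assumes "continuous_on UNIV f" "finite A" "\<epsilon> > 0"
  obtains \<delta> where "\<delta> > 0" "\<And>a x. a \<in> A \<Longrightarrow> dist x a < \<delta> \<Longrightarrow> \<bar>f x - f a\<bar> < \<epsilon>"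
proof -
  have "\<forall>a. \<exists>\<delta>>0. \<forall>x. dist x a < \<delta> \<longrightarrow> \<bar>f x - f a\<bar> < \<epsilon>"
    using assms(1,3) unfolding continuous_on_iff dist_real_def by blast
  then obtain D where D: "\<And>a. D a > 0" "\<And>a x. dist x a < D a \<Longrightarrow> \<bar>f x - f a\<bar> < \<epsilon>"
    by metis
  show thesis
  proof (rule that)
    \<comment> \<open>The radius from continuity depends on the centre, and finiteness of
      \<open>A\<close> permits a minimum; the inserted 1 covers empty \<open>A\<close>.\<close>
    show "0 < Min (insert 1 (D ` A))" using assms(2) D(1) by auto
    show "\<bar>f x - f a\<bar> < \<epsilon>" if "a \<in> A" "dist x a < Min (insert 1 (D ` A))" for a x
      using that assms(2) by (intro D(2)) auto
  qed
qed

theorem theorem7p3: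
  fixes f :: "'a::metric_linear_order \<Rightarrow> real"
  assumes "range f \<subseteq> {0..1}"
    and "strongly_regulated f"
    and "continuous_on UNIV f"
  shows "qf_definable (\<lambda>\<sigma> :: unit \<Rightarrow> 'a. f (\<sigma> ()))"
proof (rule qf_definableI)
  fix \<epsilon> :: real assume \<epsilon>: "\<epsilon> > 0"
  obtain A where A: "finite A" "\<And>x y. x \<le> y \<Longrightarrow> A \<inter> {x..y} = {} \<Longrightarrow> \<bar>f x - f y\<bar> < \<epsilon>"
    using strongly_regulated_endpoints[OF assms(2) \<epsilon>] by blast
  obtain \<delta> where \<delta>: "\<delta> > 0" "\<And>a x. a \<in> A \<Longrightarrow> dist x a < \<delta> \<Longrightarrow> \<bar>f x - f a\<bar> < \<epsilon> / 2"
    using continuous_finite_uniform_radius[OF assms(3) A(1), of "\<epsilon> / 2"] \<epsilon> by auto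
  have near: "\<bar>f x - f y\<bar> < \<epsilon>"
    if le: "x \<le> y" and d: "\<And>a. a \<in> A \<Longrightarrow> \<bar>dist x a - dist y a\<bar> < \<delta> / 2"
      and r: "\<And>a. a \<in> A \<Longrightarrow> \<bar>ray_dist x a - ray_dist y a\<bar> < \<delta> / 2" for x y
  proof (cases "A \<inter> {x..y} = {}")
    case True
    then show ?thesis using A(2) le by blast
  next
    case False
    then obtain a where a: "a \<in> A" "x \<le> a" "a \<le> y" by auto
    \<comment> \<open>The ray values are 0 at \<open>x\<close> and \<open>dist y a\<close> at
      \<open>y\<close>, so their closeness bounds \<open>dist y a\<close>. The metric atoms then
      place \<open>x\<close> within \<delta>/2 + \<delta>/2 of \<open>a\<close>, and
      \<open>f a\<close> links \<open>f x\<close> to \<open>f y\<close> at a cost of \<epsilon>/2 on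
      each side.\<close>
    then have "dist y a < \<delta> / 2"
      using r[of a] by (simp add: ray_dist_eq_0 ray_dist_eq_dist)
    moreover from this have "dist x a < \<delta>"
      using d[OF a(1)] by linarith
    ultimately show ?thesis
      using \<delta>(2)[OF a(1), of x] \<delta>(2)[OF a(1), of y] \<delta>(1) by linarith
  qed
  obtain as where as: "set as = A" using finite_list[OF A(1)] by blast
  define \<phi>s :: "(unit, 'a) qf_formula list" where
    "\<phi>s = map (\<lambda>a. Dist (Var ()) (Param a)) as @ map (\<lambda>a. Ray (Var ()) (Param a)) as"
  have mod: "f (\<sigma> ()) \<le> f (\<tau> ()) + \<epsilon>"
    if "\<And>\<phi>. \<phi> \<in> set \<phi>s \<Longrightarrow> \<bar>qf_val \<sigma> \<phi> - qf_val \<tau> \<phi>\<bar> < \<delta> / 2" for \<sigma> \<tau>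
  proof -
    have d: "\<bar>dist (\<sigma> ()) a - dist (\<tau> ()) a\<bar> < \<delta> / 2" if "a \<in> A" for a
      using \<open>\<And>\<phi>. \<phi> \<in> set \<phi>s \<Longrightarrow> _\<close>[of "Dist (Var ()) (Param a)"] that as by (simp add: \<phi>s_def)
    have r: "\<bar>ray_dist (\<sigma> ()) a - ray_dist (\<tau> ()) a\<bar> < \<delta> / 2" if "a \<in> A" for a
      using \<open>\<And>\<phi>. \<phi> \<in> set \<phi>s \<Longrightarrow> _\<close>[of "Ray (Var ()) (Param a)"] that as by (simp add: \<phi>s_def)
    have "\<bar>f (\<sigma> ()) - f (\<tau> ())\<bar> < \<epsilon>"
    \<comment> \<open>\<open>near\<close> needs an ordered pair, since the ray atoms treat the two
      sides of \<open>a\<close> differently; closeness of atomic values is symmetric, so the points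
      may be swapped.\<close>
    proof (cases "\<sigma> () \<le> \<tau> ()")
      case True
      then show ?thesis using d r by (rule near)
    next
      case False
      then have "\<bar>f (\<tau> ()) - f (\<sigma> ())\<bar> < \<epsilon>"
        using d r by (intro near) (auto simp: abs_minus_commute)
      then show ?thesis by (simp add: abs_minus_commute)
    qed
    then show ?thesis by linarith
  qed
  obtain \<psi> :: "(unit, 'a) qf_formula"
    where "qf_wf \<psi>" "\<And>\<sigma>. \<bar>qf_val \<sigma> \<psi> - f (\<sigma> ())\<bar> \<le> \<epsilon>"
  proof (rule qf_formula_approx[of "\<lambda>\<sigma>. f (\<sigma> ())" \<phi>s "\<delta> / 2" \<epsilon>])
    show "f (\<sigma> ()) \<in> {0..1}" for \<sigma> using assms(1) by blast
    show "qf_wf \<phi>" if "\<phi> \<in> set \<phi>s" for \<phi> using that by (auto simp: \<phi>s_def)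
  qed (use \<delta>(1) \<epsilon> mod in auto)
  then show "\<exists>\<psi> :: (unit, 'a) qf_formula. qf_wf \<psi> \<and> (\<forall>\<sigma>. \<bar>qf_val \<sigma> \<psi> - f (\<sigma> ())\<bar> \<le> \<epsilon>)"
    by blast
qed

end
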